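(* Let $m\le M$ be real numbers, let $x_1,\dots,x_n$ be real numbers with $m\le x_i\le M$ for $i=1,\dots,n$, and let $p_1,\dots,p_n\ge 0$ with $\sum_{i=1}^n p_i=1$. Let $\mu_1'=\sum_{i=1}^n p_i x_i$ and $\mu_r=\sum_{i=1}^n p_i(x_i-\mu_1')^r$ for $r=2,3,4$. Then $$\mu_3^2\le \mu_2\mu_4-\mu_2^3\le \frac{(M-m)^6}{108}$$ and $$\mu_3^2\le (M-m)^2\mu_2^2-4\mu_2^3\le \frac{(M-m)^6}{108}.$$
   Context: The numbers $x_i$ are the values of a discrete random variable, taken with probabilities $p_i$; $\mu_1'$ is its mean and $\mu_r$ its $r$-th central moment. *)

theory Defs
  imports Complex_Main
begin

definition weighted_mean :: "nat \<Rightarrow> (nat \<Rightarrow> real) \<Rightarrow> (nat \<Rightarrow> real) \<Rightarrow> real" where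
  "weighted_mean n p x = (\<Sum>i = 1..n. p i * x i)"

definition central_moment :: "nat \<Rightarrow> (nat \<Rightarrow> real) \<Rightarrow> (nat \<Rightarrow> real) \<Rightarrow> nat \<Rightarrow> real" where
  "central_moment n p x r = (\<Sum>i = 1..n. p i * (x i - weighted_mean n p x) ^ r)"

end

theory Submission
  imports Defs
begin

text \<open>
  Let \<open>y\<^sub>i = x\<^sub>i - \<mu>\<^sub>1'\<close>, which lies in \<open>[a, b]\<close> with \<open>a = m - \<mu>\<^sub>1'\<close>, \<open>b = M - \<mu>\<^sub>1'\<close>, and put \<open>d = b - a = M - m\<close>.
  Pearson's inequality \<open>\<mu>\<^sub>3\<^sup>2 \<le> \<mu>\<^sub>2 \<mu>\<^sub>4 - \<mu>\<^sub>2\<^sup>3\<close> says that the quadratic polynomial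
  \<open>t \<mapsto> E(y\<^sup>2 - \<mu>\<^sub>2 - t y)\<^sup>2\<close> is nonnegative.
  Averaging \<open>(b - y) (y + \<mu>\<^sub>2 / b)\<^sup>2 \<ge> 0\<close> gives \<open>\<mu>\<^sub>3 \<le> b \<mu>\<^sub>2 - \<mu>\<^sub>2\<^sup>2 / b\<close>; with \<open>\<mu>\<^sub>2 \<le> - a b\<close> and the reflected
  estimate this yields \<open>\<mu>\<^sub>3\<^sup>2 \<le> d\<^sup>2 \<mu>\<^sub>2\<^sup>2 - 4 \<mu>\<^sub>2\<^sup>3\<close>.
  Averaging \<open>y\<^sup>2 (y - a) (b - y) \<ge> 0\<close> gives \<open>\<mu>\<^sub>4 \<le> (a + b) \<mu>\<^sub>3 - a b \<mu>\<^sub>2\<close>; since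
  \<open>2 \<mu>\<^sub>2 (a + b) \<mu>\<^sub>3 \<le> \<mu>\<^sub>2\<^sup>2 (a + b)\<^sup>2 + \<mu>\<^sub>3\<^sup>2\<close>, also \<open>\<mu>\<^sub>2 \<mu>\<^sub>4 - \<mu>\<^sub>2\<^sup>3 \<le> d\<^sup>2 \<mu>\<^sub>2\<^sup>2 - 4 \<mu>\<^sub>2\<^sup>3\<close>.
  The remaining bound is \<open>D\<^sup>3 - 108 D v\<^sup>2 + 432 v\<^sup>3 = (D - 6 v)\<^sup>2 (D + 12 v)\<close> for \<open>D = d\<^sup>2\<close>, \<open>v = \<mu>\<^sub>2\<close>.
\<close>

text \<open>For \<open>0 < v\<close>, evaluate at the minimiser \<open>t = k / v\<close>; for
  \<open>v = 0\<close>, an affine function of \<open>t\<close> that stays nonnegative is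
  constant.\<close>

lemma discriminant_le_of_nonneg:
  fixes u k v :: real
  assumes "0 \<le> v" and nonneg: "\<And>t. 0 \<le> u - 2 * t * k + t\<^sup>2 * v"
  shows "k\<^sup>2 \<le> v * u"
proof (cases "v = 0")
  case True
  have "k = 0"
  proof (rule ccontr)
    assume "k \<noteq> 0"
    then have "u - 2 * ((u + 1) / (2 * k)) * k = - 1"
      by (simp add: field_simps)
    with nonneg[of "(u + 1) / (2 * k)"] True show False by simp
  qed
  with True show ?thesis by simp
next
  case False
  with \<open>0 \<le> v\<close> have "0 < v" by simp
  then have "u - 2 * (k / v) * k + (k / v)\<^sup>2 * v = u - k\<^sup>2 / v"
    by (simp add: power2_eq_square field_simps)
  with nonneg[of "k / v"] have "k\<^sup>2 / v \<le> u" by simp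
  with \<open>0 < v\<close> show ?thesis by (simp add: field_simps)
qed

text \<open>Over \<open>v\<close> \<ge> 0 the left side peaks at \<open>v = D / 6\<close>, whence
  the double factor.\<close>

lemma cubic_le_cube_div_108:
  fixes v D :: real
  assumes "0 \<le> v" "0 \<le> D"
  shows "D * v\<^sup>2 - 4 * v ^ 3 \<le> D ^ 3 / 108"
proof -
  have "0 \<le> (D - 6 * v)\<^sup>2 * (D + 12 * v)" using assms by simp
  also have "\<dots> = D ^ 3 - 108 * (D * v\<^sup>2 - 4 * v ^ 3)"
    by (simp add: power2_eq_square power3_eq_cube algebra_simps)
  finally show ?thesis by simp
qed

locale centered_weights =
  fixes A :: "'a set" and p y :: "'a \<Rightarrow> real" and a b :: real
  assumes weight_nonneg: "i \<in> A \<Longrightarrow> 0 \<le> p i"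
    and weight_sum: "(\<Sum>i\<in>A. p i) = 1"
    and mean_zero: "(\<Sum>i\<in>A. p i * y i) = 0"
    and lower: "i \<in> A \<Longrightarrow> a \<le> y i"
    and upper: "i \<in> A \<Longrightarrow> y i \<le> b"
begin

definition moment :: "nat \<Rightarrow> real" where
  "moment r = (\<Sum>i\<in>A. p i * y i ^ r)"

lemma quartic_average:
  "(\<Sum>i\<in>A. p i * (c0 + c1 * y i + c2 * y i ^ 2 + c3 * y i ^ 3 + c4 * y i ^ 4))
    = c0 + c2 * moment 2 + c3 * moment 3 + c4 * moment 4"
proof -
  have "(\<Sum>i\<in>A. p i * (c0 + c1 * y i + c2 * y i ^ 2 + c3 * y i ^ 3 + c4 * y i ^ 4))
    = c0 * (\<Sum>i\<in>A. p i) + c1 * (\<Sum>i\<in>A. p i * y i) + c2 * moment 2 + c3 * moment 3 + c4 * moment 4"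
    unfolding moment_def sum_distrib_left sum.distrib[symmetric]
    by (intro sum.cong) (auto simp: algebra_simps)
  then show ?thesis by (simp add: weight_sum mean_zero)
qed

text \<open>Turns a pointwise polynomial inequality into one between moments; \<open>c1\<close>
  drops out because the mean is zero, so callers must supply it.\<close>

lemma quartic_average_nonneg:
  assumes "\<And>i. i \<in> A \<Longrightarrow> 0 \<le> c0 + c1 * y i + c2 * y i ^ 2 + c3 * y i ^ 3 + c4 * y i ^ 4"
  shows "0 \<le> c0 + c2 * moment 2 + c3 * moment 3 + c4 * moment 4"
  unfolding quartic_average[of c0 c1 c2 c3 c4, symmetric]
  by (intro sum_nonneg mult_nonneg_nonneg weight_nonneg assms)

lemma moment2_nonneg: "0 \<le> moment 2"
  unfolding moment_def by (intro sum_nonneg mult_nonneg_nonneg weight_nonneg) auto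

lemma Pearson: "(moment 3)\<^sup>2 \<le> moment 2 * moment 4 - moment 2 ^ 3"
proof -
  define v where "v = moment 2"
  have "(moment 3)\<^sup>2 \<le> v * (moment 4 - v\<^sup>2)"
  proof (rule discriminant_le_of_nonneg)
    show "0 \<le> v" using moment2_nonneg v_def by simp
    show "0 \<le> moment 4 - v\<^sup>2 - 2 * t * moment 3 + t\<^sup>2 * v" for t
    proof -
      have "v\<^sup>2 + (2 * t * v) * z + (t\<^sup>2 - 2 * v) * z ^ 2 + (- 2 * t) * z ^ 3 + 1 * z ^ 4
          = (z\<^sup>2 - v - t * z)\<^sup>2" for z :: real
        by (simp add: power2_eq_square power3_eq_cube power4_eq_xxxx algebra_simps)
      then have "0 \<le> v\<^sup>2 + (t\<^sup>2 - 2 * v) * moment 2 + (- 2 * t) * moment 3 + 1 * moment 4"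
        by (intro quartic_average_nonneg[where ?c1.0 = "2 * t * v"]) simp
      then show ?thesis
        by (simp add: v_def power2_eq_square algebra_simps)
    qed
  qed
  then show ?thesis
    by (simp add: v_def power2_eq_square power3_eq_cube algebra_simps)
qed

lemma moment2_le: "moment 2 \<le> - a * b"
proof -
  have "0 \<le> - a * b + (a + b) * z + (- 1) * z ^ 2 + 0 * z ^ 3 + 0 * z ^ 4" if "a \<le> z" "z \<le> b" for z
  proof -
    have "0 \<le> (z - a) * (b - z)" using that by simp
    also have "\<dots> = - a * b + (a + b) * z + (- 1) * z ^ 2 + 0 * z ^ 3 + 0 * z ^ 4"
      by (simp add: power2_eq_square algebra_simps)
    finally show ?thesis .
  qed
  then have "0 \<le> - a * b + (- 1) * moment 2 + 0 * moment 3 + 0 * moment 4"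
    by (intro quartic_average_nonneg[where ?c1.0 = "a + b"]) (simp_all only: lower upper)
  then show ?thesis by simp
qed

lemma moment4_le: "moment 4 \<le> (a + b) * moment 3 - a * b * moment 2"
proof -
  have "0 \<le> 0 + 0 * z + (- a * b) * z ^ 2 + (a + b) * z ^ 3 + (- 1) * z ^ 4" if "a \<le> z" "z \<le> b" for z
  proof -
    have "0 \<le> z\<^sup>2 * ((z - a) * (b - z))" using that by simp
    also have "\<dots> = 0 + 0 * z + (- a * b) * z ^ 2 + (a + b) * z ^ 3 + (- 1) * z ^ 4"
      by (simp add: power2_eq_square power3_eq_cube power4_eq_xxxx algebra_simps)
    finally show ?thesis .
  qed
  then have "0 \<le> 0 + (- a * b) * moment 2 + (a + b) * moment 3 + (- 1) * moment 4"
    by (intro quartic_average_nonneg[where ?c1.0 = 0]) (simp_all only: lower upper)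
  then show ?thesis by simp
qed

lemma moment3_upper:
  assumes "0 < b"
  shows "b * moment 3 \<le> b\<^sup>2 * moment 2 - (moment 2)\<^sup>2"
proof -
  \<comment> \<open>The mean-zero distribution on the two points \<open>b\<close> and
    \<open>c\<close> has variance \<open>- b * c = moment 2\<close> and attains equality.\<close>
  define c where "c = - moment 2 / b"
  have "0 \<le> b * c\<^sup>2 + (- 2 * b * c - c\<^sup>2) * z + (b + 2 * c) * z ^ 2 + (- 1) * z ^ 3 + 0 * z ^ 4"
    if "z \<le> b" for z
  proof -
    have "0 \<le> (b - z) * (z - c)\<^sup>2" using that by simp
    also have "\<dots> = b * c\<^sup>2 + (- 2 * b * c - c\<^sup>2) * z + (b + 2 * c) * z ^ 2 + (- 1) * z ^ 3 + 0 * z ^ 4"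
      by (simp add: power2_eq_square power3_eq_cube algebra_simps)
    finally show ?thesis .
  qed
  then have "0 \<le> b * c\<^sup>2 + (b + 2 * c) * moment 2 + (- 1) * moment 3 + 0 * moment 4"
    by (intro quartic_average_nonneg[where ?c1.0 = "- 2 * b * c - c\<^sup>2"]) (simp_all only: upper)
  then have "b * moment 3 \<le> b * (b * c\<^sup>2 + (b + 2 * c) * moment 2)"
    using assms by simp
  also have "\<dots> = (b * c)\<^sup>2 + b\<^sup>2 * moment 2 + 2 * (b * c) * moment 2"
    by (simp add: power2_eq_square algebra_simps)
  also have "b * c = - moment 2" using assms by (simp add: c_def)
  finally show ?thesis by (simp add: power2_eq_square)
qed

lemma moment3_square_le_of_nonneg:
  assumes "0 \<le> moment 3"
  shows "(moment 3)\<^sup>2 \<le> (b - a)\<^sup>2 * (moment 2)\<^sup>2 - 4 * moment 2 ^ 3"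
proof (cases "moment 2 = 0")
  case True
  then show ?thesis using Pearson by simp
next
  case False
  define v where "v = moment 2"
  have "0 < v" using False moment2_nonneg v_def by simp
  have "A \<noteq> {}" using weight_sum by auto
  then have "a \<le> b" using lower upper by force
  have "v \<le> - a * b" using moment2_le v_def by simp
  have "0 < b"
  proof (rule ccontr)
    assume "\<not> 0 < b"
    with \<open>a \<le> b\<close> have "0 \<le> a * b" by (intro mult_nonpos_nonpos) auto
    with \<open>v \<le> - a * b\<close> \<open>0 < v\<close> show False by simp
  qed
  have "(b * moment 3)\<^sup>2 \<le> (b\<^sup>2 * v - v\<^sup>2)\<^sup>2"
    using moment3_upper[OF \<open>0 < b\<close>] \<open>0 < b\<close> assms by (intro power_mono) (auto simp: v_def)
  \<comment> \<open>Trading \<open>b\<^sup>2 - v\<close> for \<open>b\<^sup>2 + v\<close> splits off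
    the term \<open>- 4 * v ^ 3\<close> and leaves a square that \<open>v \<le> - a * b\<close>
    bounds.\<close>
  also have "\<dots> = v\<^sup>2 * ((b\<^sup>2 + v)\<^sup>2 - 4 * v * b\<^sup>2)"
    by (simp add: power2_eq_square algebra_simps)
  also have "\<dots> \<le> v\<^sup>2 * ((b * (b - a))\<^sup>2 - 4 * v * b\<^sup>2)"
  proof -
    have "b\<^sup>2 + v \<le> b * (b - a)"
      using \<open>v \<le> - a * b\<close> by (simp add: power2_eq_square algebra_simps)
    then have "(b\<^sup>2 + v)\<^sup>2 \<le> (b * (b - a))\<^sup>2"
      using \<open>0 < v\<close> by (intro power_mono) auto
    then show ?thesis by (intro mult_left_mono) auto
  qed
  also have "\<dots> = b\<^sup>2 * ((b - a)\<^sup>2 * v\<^sup>2 - 4 * v ^ 3)"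
    by (simp add: power2_eq_square power3_eq_cube algebra_simps)
  finally show ?thesis
    using \<open>0 < b\<close> by (simp add: power_mult_distrib v_def)
qed

end

text \<open>Reflection flips the sign of the third moment and keeps the second moment and the
  interval length.\<close>

lemma centered_weights_uminus:
  assumes "centered_weights A p y a b"
  shows "centered_weights A p (\<lambda>i. - y i) (- b) (- a)"
  using assms unfolding centered_weights_def by (auto simp: sum_negf)

context centered_weights
begin

lemma moment3_square_le:
  "(moment 3)\<^sup>2 \<le> (b - a)\<^sup>2 * (moment 2)\<^sup>2 - 4 * moment 2 ^ 3"
proof (cases "0 \<le> moment 3")
  case True
  then show ?thesis by (rule moment3_square_le_of_nonneg)
next
  case False
  interpret neg: centered_weights A p "\<lambda>i. - y i" "- b" "- a"
    using centered_weights_axioms by (rule centered_weights_uminus)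
  have "neg.moment 2 = moment 2" "neg.moment 3 = - moment 3"
    by (simp_all add: neg.moment_def moment_def sum_negf)
  with neg.moment3_square_le_of_nonneg False show ?thesis
    by (simp add: algebra_simps)
qed

lemma moment2_moment4_le:
  "moment 2 * moment 4 - moment 2 ^ 3 \<le> (b - a)\<^sup>2 * (moment 2)\<^sup>2 - 4 * moment 2 ^ 3"
proof -
  define v k where "v = moment 2" and "k = moment 3"
  have v: "0 \<le> v" "v \<le> - a * b" using moment2_nonneg moment2_le v_def by auto
  have "v * moment 4 \<le> v * ((a + b) * k - a * b * v)"
    using moment4_le v by (intro mult_left_mono) (auto simp: v_def k_def)
  moreover have "2 * (v * (a + b)) * k \<le> (v * (a + b))\<^sup>2 + k\<^sup>2"
    by (rule sum_squares_bound)
  moreover have "k\<^sup>2 \<le> (b - a)\<^sup>2 * v\<^sup>2 - 4 * v ^ 3"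
    using moment3_square_le by (simp add: v_def k_def)
  moreover have "v\<^sup>2 * v \<le> v\<^sup>2 * (- a * b)"
    using v by (intro mult_left_mono) auto
  \<comment> \<open>Add the first and last bounds and half of the other two, using \<open>(a +
    b)\<^sup>2 + (b - a)\<^sup>2 = 2 * (a\<^sup>2 + b\<^sup>2)\<close>.\<close>
  ultimately have "v * moment 4 - v ^ 3 \<le> (b - a)\<^sup>2 * v\<^sup>2 - 4 * v ^ 3"
    by (simp add: power2_eq_square power3_eq_cube algebra_simps)
  then show ?thesis by (simp add: v_def)
qed

end

theorem theorem2p6:
  fixes n :: nat and m M :: real and x p :: "nat \<Rightarrow> real" and \<mu> :: "nat \<Rightarrow> real"
  assumes "m \<le> M"
    and "\<And>i. i \<in> {1..n} \<Longrightarrow> m \<le> x i \<and> x i \<le> M"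
    and "\<And>i. i \<in> {1..n} \<Longrightarrow> 0 \<le> p i"
    and "(\<Sum>i = 1..n. p i) = 1"
  defines "\<mu> \<equiv> central_moment n p x"
  shows "(\<mu> 3)\<^sup>2 \<le> \<mu> 2 * \<mu> 4 - (\<mu> 2) ^ 3
       \<and> \<mu> 2 * \<mu> 4 - (\<mu> 2) ^ 3 \<le> (M - m) ^ 6 / 108
       \<and> (\<mu> 3)\<^sup>2 \<le> (M - m)\<^sup>2 * (\<mu> 2)\<^sup>2 - 4 * (\<mu> 2) ^ 3
       \<and> (M - m)\<^sup>2 * (\<mu> 2)\<^sup>2 - 4 * (\<mu> 2) ^ 3 \<le> (M - m) ^ 6 / 108"
proof -
  define e where "e = weighted_mean n p x"
  have "(\<Sum>i = 1..n. p i * (x i - e)) = weighted_mean n p x - (\<Sum>i = 1..n. p i) * e"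
    by (simp add: weighted_mean_def algebra_simps sum_subtractf sum_distrib_left)
  then have "(\<Sum>i = 1..n. p i * (x i - e)) = 0"
    using assms(4) by (simp add: e_def)
  then interpret centered_weights "{1..n}" p "\<lambda>i. x i - e" "m - e" "M - e"
    using assms by unfold_locales auto
  have \<mu>: "\<mu> r = moment r" for r
    by (simp only: \<mu>_def central_moment_def moment_def flip: e_def)
  have "(M - m)\<^sup>2 * (moment 2)\<^sup>2 - 4 * moment 2 ^ 3 \<le> (M - m) ^ 6 / 108"
    using cubic_le_cube_div_108[OF moment2_nonneg, of "(M - m)\<^sup>2"]
    by (simp flip: power_mult)
  then show ?thesis
    using Pearson moment2_moment4_le moment3_square_le by (simp add: \<mu>)
qed

end
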